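(* Let $\sigma>0$, let $V\in\mathbb{R}$, let $\psi:\mathbb{R}\to\mathbb{R}$ be a smooth $1$-periodic function, and set $\Psi(x,t):=\psi(x-Vt)$. Consider the diffusion process $$\rho_t=\left(\sigma\rho_x+\Psi_x\,\rho\right)_x,\qquad \rho(0,t)=\rho(1,t),\quad \rho_x(0,t)=\rho_x(1,t),$$ for a probability density $\rho$, and let $\kappa$ be its mean velocity. Then this process is a transport process, i.e. $\kappa\neq 0$, if and only if $V\neq 0$ and $\psi$ is not constant. Moreover, the mean velocity is always in the direction of $V$ (that is, $\kappa V\ge 0$, so that $\kappa$ has the same sign as $V$ whenever $\kappa\ne0$), and $|\kappa|\le |V|$.
   Context: Here $\rho=\rho(x,t)$ is a strictly positive classical solution, smooth on $\mathbb{R}\times[0,\infty)$ and $1$-periodic in $x$, of $\rho_t=(\sigma\rho_x+\Psi_x\rho)_x$ with $\int_0^1\rho(x,t)\,dx=1$ for all $t\ge 0$. Velocity field: $v(x,t):=-\Psi_x(x,t)-\sigma\,\rho_x(x,t)/\rho(x,t)$, so that the diffusion equation is the continuity equation $\rho_t+(v\rho)_x=0$. A particle orbit is a solution $x:[0,\infty)\to\mathbb{R}$ of $\frac{dx}{dt}=v(x(t),t)$, where $v$ is extended $1$-periodically in $x$ to $\mathbb{R}$. Mean velocity: $\kappa:=\lim_{t\to\infty}\frac{x(t)}{t}$. This limit exists and is independent of the initial position $x(0)$ and of the initial density $\rho(\cdot,0)$. The process is called a transport process if $\kappa\neq 0$. The number $V$ is called the applied voltage. *)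

theory Defs
  imports "HOL-Analysis.Analysis"
begin

definition smooth_real :: "(real \<Rightarrow> real) \<Rightarrow> bool" where
  "smooth_real f \<longleftrightarrow> (\<forall>n x. (deriv ^^ n) f field_differentiable at x)"

text \<open>Smoothness of \<open>f x t\<close> on the closed half plane \<open>t \<ge> 0\<close>, up to the boundary: all mixed partial
  derivatives, in any order, exist and are jointly continuous. \<open>D i j\<close> is the derivative of order
  \<open>i\<close> in \<open>x\<close> and \<open>j\<close> in \<open>t\<close>; at \<open>t = 0\<close> the derivative in \<open>t\<close> is one-sided.\<close>

definition smooth_half_plane :: "(real \<Rightarrow> real \<Rightarrow> real) \<Rightarrow> bool" where
  "smooth_half_plane f \<longleftrightarrow>
    (\<exists>D :: nat \<Rightarrow> nat \<Rightarrow> real \<Rightarrow> real \<Rightarrow> real.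
      (\<forall>x. \<forall>t\<ge>0. D 0 0 x t = f x t) \<and>
      (\<forall>i j. continuous_on (UNIV \<times> {0..}) (\<lambda>(x, t). D i j x t)) \<and>
      (\<forall>i j x. \<forall>t\<ge>0. ((\<lambda>y. D i j y t) has_real_derivative D (Suc i) j x t) (at x)) \<and>
      (\<forall>i j x. \<forall>t\<ge>0. ((\<lambda>s. D i j x s) has_real_derivative D i (Suc j) x t) (at t within {0..})))"

definition dx :: "(real \<Rightarrow> real \<Rightarrow> real) \<Rightarrow> real \<Rightarrow> real \<Rightarrow> real" where
  "dx f x t = deriv (\<lambda>y. f y t) x"

text \<open>Strictly positive classical solutions, with unit mass, of
  \<open>\<rho>\<^sub>t = (\<sigma> \<rho>\<^sub>x + \<Psi>\<^sub>x \<rho>)\<^sub>x\<close>. Densities are extended 1-periodically to the real line, which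
  subsumes the boundary conditions \<open>\<rho>(0,t) = \<rho>(1,t)\<close> and \<open>\<rho>\<^sub>x(0,t) = \<rho>\<^sub>x(1,t)\<close>.\<close>

definition diffusion_solution ::
    "real \<Rightarrow> (real \<Rightarrow> real \<Rightarrow> real) \<Rightarrow> (real \<Rightarrow> real \<Rightarrow> real) \<Rightarrow> bool" where
  "diffusion_solution \<sigma> \<Psi> \<rho> \<longleftrightarrow>
    smooth_half_plane \<rho> \<and>
    (\<forall>x. \<forall>t\<ge>0. 0 < \<rho> x t) \<and>
    (\<forall>x. \<forall>t\<ge>0. \<rho> (x + 1) t = \<rho> x t) \<and>
    (\<forall>t\<ge>0. ((\<lambda>x. \<rho> x t) has_integral 1) {0..1}) \<and>
    (\<forall>x. \<forall>t\<ge>0. ((\<lambda>s. \<rho> x s) has_real_derivative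
        dx (\<lambda>y s. \<sigma> * dx \<rho> y s + dx \<Psi> y s * \<rho> y s) x t) (at t within {0..}))"

definition velocity ::
    "real \<Rightarrow> (real \<Rightarrow> real \<Rightarrow> real) \<Rightarrow> (real \<Rightarrow> real \<Rightarrow> real) \<Rightarrow> real \<Rightarrow> real \<Rightarrow> real" where
  "velocity \<sigma> \<Psi> \<rho> x t = - dx \<Psi> x t - \<sigma> * dx \<rho> x t / \<rho> x t"

definition particle_orbit :: "(real \<Rightarrow> real \<Rightarrow> real) \<Rightarrow> (real \<Rightarrow> real) \<Rightarrow> bool" where
  "particle_orbit v x \<longleftrightarrow> (\<forall>t\<ge>0. (x has_real_derivative v (x t) t) (at t within {0..}))"

text \<open>The mean velocity belongs to the process, not to a particular density or orbit: it is the
  common limit of \<open>x(t)/t\<close> over all orbits of all solutions.\<close>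

definition mean_velocity :: "real \<Rightarrow> (real \<Rightarrow> real \<Rightarrow> real) \<Rightarrow> real" where
  "mean_velocity \<sigma> \<Psi> =
    (THE \<kappa>. \<forall>\<rho> x. diffusion_solution \<sigma> \<Psi> \<rho> \<longrightarrow> particle_orbit (velocity \<sigma> \<Psi> \<rho>) x \<longrightarrow>
      ((\<lambda>t. x t / t) \<longlongrightarrow> \<kappa>) at_top)"

definition transport_process :: "real \<Rightarrow> (real \<Rightarrow> real \<Rightarrow> real) \<Rightarrow> bool" where
  "transport_process \<sigma> \<Psi> \<longleftrightarrow> mean_velocity \<sigma> \<Psi> \<noteq> 0"

end

theory Submission
  imports Defs
begin

text \<open>
  In the moving frame \<open>z = x - V t\<close> the flux operator \<open>J = - (\<sigma> \<partial>\<^sub>z + \<psi>' + V)\<close> has time-independent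
  coefficients, and its adjoint equation \<open>\<sigma> w' - (\<psi>' + V) w = - c\<close> has, for exactly one \<open>c\<close>, a positive
  periodic solution \<open>w\<close> of mean one. If \<open>U' = w\<close>, the integral of \<open>U\<close> against the density over one
  period starting at the particle has time derivative exactly \<open>- c\<close> along every orbit of every solution,
  and it stays within a bounded distance of the particle. Hence \<open>\<kappa> = V - c\<close>, with no convergence to
  equilibrium needed. If \<open>V \<noteq> 0\<close> and \<open>c = V q\<close>, integration of the equation for \<open>ln w\<close> over a period shows that
  \<open>1 / w\<close> has mean \<open>1 / q\<close>, so \<open>w + 1 / w \<ge> 2\<close> gives \<open>q \<le> 1\<close>, with equality only for \<open>w = 1\<close>, that is,
  \<open>\<psi>' = 0\<close>.

  A travelling wave and one of its orbits are constructed as well: without them every number would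
  vacuously be a common limit and the definite description in \<open>mean_velocity\<close> would be meaningless.
\<close>

section \<open>Finite orders of differentiability and smoothness of solutions of linear
  equations\<close>

text \<open>A graded form of smoothness that can be proved by induction: the derivative of a product
  or of a solution of a differential equation has one order less but involves the original
  functions, so the claim must be made order by order for all functions at once.\<close>

definition differentiable_upto :: "nat \<Rightarrow> (real \<Rightarrow> real) \<Rightarrow> bool" where
  "differentiable_upto n f \<longleftrightarrow> (\<forall>k<n. \<forall>x. (deriv ^^ k) f field_differentiable at x)"

lemma differentiable_upto_0 [simp]: "differentiable_upto 0 f"
  by (simp add: differentiable_upto_def)

lemma differentiable_upto_Suc:
  "differentiable_upto (Suc n) f \<longleftrightarrow>
    (\<forall>x. f field_differentiable at x) \<and> differentiable_upto n (deriv f)"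
  unfolding differentiable_upto_def All_less_Suc2
  by (simp add: funpow_swap1)

lemma smooth_real_iff_upto: "smooth_real f \<longleftrightarrow> (\<forall>n. differentiable_upto n f)"
  unfolding smooth_real_def differentiable_upto_def by blast

lemma differentiable_upto_mono: "differentiable_upto n f \<Longrightarrow> m \<le> n \<Longrightarrow> differentiable_upto m f"
  by (simp add: differentiable_upto_def)

lemma differentiable_upto_const [simp]: "differentiable_upto n (\<lambda>_. c)"
proof (induction n arbitrary: c)
  case (Suc n)
  have "deriv (\<lambda>_::real. c) = (\<lambda>_. 0)" by (rule ext) simp
  with Suc show ?case by (simp add: differentiable_upto_Suc field_differentiable_const)
qed simp

lemma differentiable_upto_add:
  "differentiable_upto n f \<Longrightarrow> differentiable_upto n g \<Longrightarrow> differentiable_upto n (\<lambda>x. f x + g x)"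
proof (induction n arbitrary: f g)
  case (Suc n)
  have "deriv (\<lambda>x. f x + g x) = (\<lambda>x. deriv f x + deriv g x)"
    using Suc.prems by (intro ext deriv_add) (auto simp: differentiable_upto_Suc)
  with Suc show ?case by (auto simp: differentiable_upto_Suc intro: field_differentiable_add)
qed simp

lemma differentiable_upto_mult:
  "differentiable_upto n f \<Longrightarrow> differentiable_upto n g \<Longrightarrow> differentiable_upto n (\<lambda>x. f x * g x)"
proof (induction n arbitrary: f g)
  case (Suc n)
  have "deriv (\<lambda>x. f x * g x) = (\<lambda>x. f x * deriv g x + deriv f x * g x)"
    using Suc.prems by (intro ext deriv_mult) (auto simp: differentiable_upto_Suc)
  moreover have "differentiable_upto n f" "differentiable_upto n g"
    using Suc.prems differentiable_upto_mono by (metis Suc_leD le_refl)+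
  ultimately show ?case
    using Suc.prems
    by (auto simp: differentiable_upto_Suc intro!: Suc.IH differentiable_upto_add field_differentiable_mult)
qed simp

text \<open>Bootstrapping: the equation writes \<open>deriv f\<close> as a polynomial in
  \<open>f\<close> and \<open>g\<close>, so \<open>n\<close> orders of differentiability of
  \<open>f\<close> pass to \<open>deriv f\<close> and give one order more for
  \<open>f\<close>.\<close>

lemma smooth_real_linear_ode:
  fixes f g :: "real \<Rightarrow> real"
  assumes g: "smooth_real g"
    and f: "\<And>x. (f has_real_derivative b + g x * f x) (at x)"
  shows "smooth_real f"
  unfolding smooth_real_iff_upto
proof
  fix n show "differentiable_upto n f"
  proof (induction n)
    case (Suc n)
    have "deriv f = (\<lambda>x. b + g x * f x)"
      using f by (intro ext DERIV_imp_deriv)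
    then show ?case
      using Suc g f
      by (auto simp: differentiable_upto_Suc smooth_real_iff_upto field_differentiable_def
          intro!: differentiable_upto_add differentiable_upto_mult)
  qed simp
qed

lemma smooth_real_deriv: "smooth_real f \<Longrightarrow> smooth_real (deriv f)"
  by (meson differentiable_upto_Suc smooth_real_iff_upto)

lemma smooth_real_DERIV:
  "smooth_real f \<Longrightarrow> ((deriv ^^ n) f has_real_derivative (deriv ^^ Suc n) f x) (at x)"
  by (simp add: smooth_real_def DERIV_deriv_iff_field_differentiable)

section \<open>Antiderivatives, periodic functions and monotone functions on the line\<close>

lemma antiderivative_ex:
  fixes f :: "real \<Rightarrow> real"
  assumes "\<And>x. isCont f x"
  obtains F where "\<And>x. (F has_real_derivative f x) (at x)"
  using einterval_antiderivative[of "-\<infinity>" "\<infinity>" f] assms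
  by (auto simp: has_real_derivative_iff_has_vector_derivative)

lemma periodic_deriv:
  fixes f f' :: "real \<Rightarrow> real"
  assumes f: "\<And>x. (f has_real_derivative f' x) (at x)" and p: "\<And>x. f (x + 1) = f x"
  shows "f' (x + 1) = f' x"
proof -
  have "((\<lambda>y. f (y + 1)) has_real_derivative f' (x + 1)) (at x)"
    using f[of "x + 1"] by (simp add: DERIV_shift)
  then show ?thesis
    using f[of x] by (simp add: p DERIV_unique)
qed

lemma periodic_bounded:
  fixes f :: "real \<Rightarrow> real"
  assumes c: "\<And>x. isCont f x" and p: "\<And>x. f (x + 1) = f x"
  obtains B where "\<And>x. \<bar>f x\<bar> \<le> B"
proof -
  interpret periodic_fun_simple' f using p by unfold_locales
  have "compact (f ` {0..1})"
    using c by (intro compact_continuous_image continuous_at_imp_continuous_on) auto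
  then obtain B where B: "\<And>x. x \<in> {0..1} \<Longrightarrow> \<bar>f x\<bar> \<le> B"
    by (force dest!: compact_imp_bounded simp: bounded_iff)
  have "\<bar>f x\<bar> \<le> B" for x
  proof -
    have "f x = f (frac x + of_int \<lfloor>x\<rfloor>)" by (simp add: frac_def)
    then have "f x = f (frac x)" by (simp only: plus_of_int)
    with B[of "frac x"] show ?thesis by (simp add: frac_lt_1 less_imp_le)
  qed
  then show thesis using that by blast
qed

text \<open>A nondecreasing function with equal end values is constant in between. This settles the
  equality case of the bound on the mean velocity.\<close>

lemma DERIV_nonneg_eq_imp_zero:
  fixes f f' :: "real \<Rightarrow> real"
  assumes f: "\<And>x. (f has_real_derivative f' x) (at x)" and nn: "\<And>x. f' x \<ge> 0"
    and "f b = f a" and x: "a < x" "x < b"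
  shows "f' x = 0"
proof -
  have mono: "f u \<le> f v" if "u \<le> v" for u v
    using DERIV_nonneg_imp_nondecreasing[OF that] f nn by blast
  have eq: "f y = f a" if "y \<in> {a<..<b}" for y
    using mono[of a y] mono[of y b] that \<open>f b = f a\<close> by simp
  have "(f has_real_derivative 0) (at x)"
    by (rule has_field_derivative_transform_within_open[where S = "{a<..<b}" and f = "\<lambda>_. f a"])
      (use eq x in auto)
  then show ?thesis using f DERIV_unique by blast
qed

section \<open>The positive periodic solution of the first-order profile equation\<close>

text \<open>An integrating factor gives the solution explicitly, and the mean of
  \<open>1 / h\<close> controls the constant \<open>q\<close>. One statement serves both signs of
  the potential: the adjoint weight that measures orbits and the stationary density in the moving
  frame.\<close>

lemma periodic_profile:
  fixes \<phi> \<phi>' :: "real \<Rightarrow> real" and a :: real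
  assumes phi: "\<And>x. (\<phi> has_real_derivative \<phi>' x) (at x)" and per: "\<And>x. \<phi> (x + 1) = \<phi> x"
  obtains h U q B where
    "\<And>x. h x > 0" "\<And>x. h (x + 1) = h x"
    "\<And>x. (h has_real_derivative a * q - (\<phi>' x + a) * h x) (at x)"
    "\<And>x. (U has_real_derivative h x) (at x)" "\<And>x. U (x + 1) = U x + 1" "\<And>x. \<bar>U x - x\<bar> \<le> B"
    "0 < q" "q \<le> 1" "a \<noteq> 0 \<longrightarrow> (q = 1 \<longleftrightarrow> (\<forall>x. \<phi>' x = 0))"
proof -
  define \<Phi> where "\<Phi> x = \<phi> x + a * x" for x
  have dPhi: "(\<Phi> has_real_derivative \<phi>' x + a) (at x)" for x
    unfolding \<Phi>_def by (auto intro!: derivative_eq_intros phi)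
  have Phi1: "\<Phi> (x + 1) = \<Phi> x + a" for x
    by (simp add: \<Phi>_def per distrib_left)
  have "isCont (\<lambda>x. exp (\<Phi> x)) x" for x
    using dPhi DERIV_isCont by (intro continuous_intros) blast
  then obtain E where dE: "\<And>x. (E has_real_derivative exp (\<Phi> x)) (at x)"
    using antiderivative_ex by blast
  have dE1: "((\<lambda>x. E (x + 1)) has_real_derivative exp (\<Phi> x + a)) (at x)" for x
    using dE[of "x + 1"] by (simp add: DERIV_shift Phi1)
  \<comment> \<open>With integrating factor \<open>exp (\<Phi> x)\<close>, the equation g' +
    (\<phi>' + a) g = const says that the derivative of \<open>exp (\<Phi> x) * g x\<close> is a
    multiple of \<open>exp (\<Phi> x)\<close>. Integrating \<open>exp (\<Phi> x)\<close> from
    \<open>x\<close> to \<open>x + 1\<close> gives the periodic solution, with constant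
    \<open>exp a - 1\<close> and no case distinction at \<open>a = 0\<close>.\<close>
  define g where "g x = exp (- \<Phi> x) * (E (x + 1) - E x)" for x
  have gpos: "g x > 0" for x
    using DERIV_pos_imp_increasing[of x "x + 1" E] dE by (force simp: g_def)
  have dg: "(g has_real_derivative (exp a - 1) - (\<phi>' x + a) * g x) (at x)" for x
  proof -
    have "exp (- \<Phi> x) * exp (\<Phi> x) = 1" by (simp flip: exp_add)
    then have e: "exp (- \<Phi> x) * (exp (\<Phi> x + a) - exp (\<Phi> x)) = exp a - 1"
      by (simp add: exp_add right_diff_distrib flip: mult.assoc)
    show ?thesis
      unfolding g_def
      by (rule derivative_eq_intros dPhi dE dE1 refl)+
        (use e in \<open>simp add: algebra_simps\<close>)
  qed
  have g1: "g (x + 1) = g x" for x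
  proof -
    \<comment> \<open>As \<open>\<Phi> (x + 1) = \<Phi> x + a\<close>, the two terms of
      \<open>K\<close> have equal derivatives. Constancy of \<open>K\<close> says that the integral
      over a period is multiplied by \<open>exp a\<close> under a unit shift, which cancels the
      change of \<open>exp (- \<Phi> x)\<close>.\<close>
    define K where "K x = E (x + 1) - exp a * E x" for x
    have "\<forall>x. (K has_real_derivative 0) (at x)"
      unfolding K_def by (auto intro!: derivative_eq_intros dE dE1 simp: exp_add)
    then have "K (x + 1) = K x" by (rule DERIV_isconst_all)
    then have "E (x + 1 + 1) - E (x + 1) = exp a * (E (x + 1) - E x)"
      by (simp add: K_def algebra_simps)
    moreover have "exp (- \<Phi> (x + 1)) = exp (- \<Phi> x) * exp (- a)"
      by (simp add: Phi1 flip: exp_add)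
    moreover have "exp (- a) * exp a = 1" by (simp flip: exp_add)
    ultimately show ?thesis by (simp add: g_def)
  qed
  have "isCont g x" for x using dg DERIV_isCont by blast
  then obtain G where dG: "\<And>x. (G has_real_derivative g x) (at x)"
    using antiderivative_ex by blast
  define m where "m = G 1 - G 0"
  have "m > 0"
    unfolding m_def using DERIV_pos_imp_increasing[of 0 1 G] dG gpos by force
  have G1: "G (x + 1) = G x + m" for x
  proof -
    have "((\<lambda>x. G (x + 1) - G x) has_real_derivative 0) (at x)" for x
      using dG[of "x + 1"] by (auto intro!: derivative_eq_intros dG simp: DERIV_shift g1)
    then have "G (x + 1) - G x = G (0 + 1) - G 0"
      using DERIV_isconst_all[of "\<lambda>x. G (x + 1) - G x"] by blast
    then show ?thesis by (simp add: m_def)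
  qed
  define h where "h x = g x / m" for x
  define U where "U x = G x / m" for x
  \<comment> \<open>Dividing \<open>g\<close> by its mean \<open>m\<close> turns the constant
    \<open>exp a - 1\<close> into \<open>a * q\<close>. For \<open>a = 0\<close> every
    \<open>q\<close> satisfies \<open>aq\<close>; the value 1 respects the bounds on
    \<open>q\<close>.\<close>
  define q where "q = (if a = 0 then 1 else (exp a - 1) / (a * m))"
  have aq: "a * q = (exp a - 1) / m" by (simp add: q_def)
  have hpos: "h x > 0" for x using gpos \<open>m > 0\<close> by (simp add: h_def)
  have h1: "h (x + 1) = h x" for x by (simp add: h_def g1)
  have dh: "(h has_real_derivative a * q - (\<phi>' x + a) * h x) (at x)" for x
    unfolding h_def aq using \<open>m > 0\<close>
    by (auto intro!: derivative_eq_intros dg simp: field_simps)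
  have dU: "(U has_real_derivative h x) (at x)" for x
    unfolding U_def h_def using \<open>m > 0\<close> by (auto intro!: derivative_eq_intros dG)
  have U1: "U (x + 1) = U x + 1" for x
    using \<open>m > 0\<close> by (simp add: U_def G1 add_divide_distrib)
  have "isCont (\<lambda>x. U x - x) x" for x
    using dU DERIV_isCont by (intro continuous_intros) blast
  then obtain B where B: "\<And>x. \<bar>U x - x\<bar> \<le> B"
    using periodic_bounded[of "\<lambda>x. U x - x"] U1 by (metis add_diff_cancel_right)
  have "0 < (exp a - 1) / a" if "a \<noteq> 0"
    using that by (cases "a > 0") (auto simp: zero_less_divide_iff)
  then have qpos: "q > 0"
    using \<open>m > 0\<close> by (auto simp: q_def simp flip: divide_divide_eq_left)
  \<comment> \<open>By the equation for \<open>h\<close>, the derivative of ln h + \<phi> + a x is a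
    q / h. Hence \<open>L\<close> is an antiderivative of h + 1/h - 2, and its increment over a
    period is 1 + 1/q - 2.\<close>
  define L where "L x = U x + (ln (h x) + \<phi> x + a * x) / (a * q) - 2 * x" for x
  have dL: "(L has_real_derivative (h x - 1)\<^sup>2 / h x) (at x)" if "a \<noteq> 0" for x
    unfolding L_def using that qpos hpos[of x]
    by (auto intro!: derivative_eq_intros dU dh phi simp: field_simps power2_eq_square)
  have L1: "L 1 = L 0 + 1 / q - 1" if "a \<noteq> 0"
    using that qpos h1[of 0] U1[of 0] per[of 0] by (simp add: L_def field_simps)
  have Lnn: "(h x - 1)\<^sup>2 / h x \<ge> 0" for x using hpos[of x] by simp
  have qle: "q \<le> 1"
  proof (cases "a = 0")
    case False
    have "L 0 \<le> L 1"
      using DERIV_nonneg_imp_nondecreasing[of 0 1 L] dL[OF False] Lnn by force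
    with L1[OF False] have "1 \<le> 1 / q" by simp
    with qpos show ?thesis by (simp add: field_simps)
  qed (simp add: q_def)
  have eq: "a \<noteq> 0 \<longrightarrow> (q = 1 \<longleftrightarrow> (\<forall>x. \<phi>' x = 0))"
  proof (intro impI iffI)
    assume a: "a \<noteq> 0" and "q = 1"
    have "h x = 1" for x
    proof -
      have L1': "L (x + 1) = L x" for x
        using a \<open>q = 1\<close> h1[of x] U1[of x] per[of x] by (simp add: L_def field_simps)
      \<comment> \<open>Two periods are used so that \<open>x\<close> is an interior point.\<close>
      have "L (x + 1) = L (x - 1)" using L1'[of x] L1'[of "x - 1"] by simp
      then have "(h x - 1)\<^sup>2 / h x = 0"
        using DERIV_nonneg_eq_imp_zero[OF dL[OF a] Lnn] by force
      with hpos[of x] show ?thesis by simp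
    qed
    then have "h = (\<lambda>_. 1)" by blast
    with dh have "((\<lambda>_. 1) has_real_derivative - \<phi>' x) (at x)" for x
      using \<open>q = 1\<close> by simp
    then show "\<forall>x. \<phi>' x = 0"
      by (metis DERIV_const DERIV_unique neg_equal_0_iff_equal)
  next
    assume a: "a \<noteq> 0" and "\<forall>x. \<phi>' x = 0"
    \<comment> \<open>For \<phi>' = 0 the equation h' = a q - a h integrates to a conserved
      quantity; its increment over a period is a - a q.\<close>
    then have "\<forall>x. ((\<lambda>x. h x + a * U x - a * q * x) has_real_derivative 0) (at x)"
      by (auto intro!: derivative_eq_intros dh dU)
    from DERIV_isconst_all[OF this, of 1 0] show "q = 1"
      using a h1[of 0] U1[of 0] by (simp add: algebra_simps)
  qed
  show thesis
    by (rule that[OF hpos h1 dh dU U1 B qpos qle eq])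
qed

section \<open>Differentiation along orbits and integration over shifted periods\<close>

text \<open>Existence of the partial in \<open>x\<close> and continuity of the partial in
  \<open>t\<close> give joint differentiability on the closed half plane, so the chain rule holds
  along a graph, one-sidedly at \<open>t = 0\<close>.\<close>

lemma DERIV_comp_half_plane:
  fixes f fx ft :: "real \<Rightarrow> real \<Rightarrow> real"
  assumes fx: "\<And>x t. 0 \<le> t \<Longrightarrow> ((\<lambda>y. f y t) has_real_derivative fx x t) (at x)"
    and ft: "\<And>x t. 0 \<le> t \<Longrightarrow> (f x has_real_derivative ft x t) (at t within {0..})"
    and c: "continuous_on (UNIV \<times> {0..}) (\<lambda>(x, t). ft x t)"
    and g: "(g has_real_derivative g') (at t within {0..})" and t: "0 \<le> t"
  shows "((\<lambda>s. f (g s) s) has_real_derivative fx (g t) t * g' + ft (g t) t) (at t within {0..})"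
proof -
  have "((\<lambda>(x, t). f x t) has_derivative
      (\<lambda>(a, b). fx (g t) t * a + blinfun_mult_right (ft (g t) t) b)) (at (g t, t) within UNIV \<times> {0..})"
  proof (rule has_derivative_partialsI[where fy = "\<lambda>x t. blinfun_mult_right (ft x t)"])
    show "((\<lambda>x. f x t) has_derivative (*) (fx (g t) t)) (at (g t) within UNIV)"
      using fx[OF t] by (simp add: has_field_derivative_def)
    show "(f x has_derivative blinfun_apply (blinfun_mult_right (ft x s))) (at s within {0..})"
      if "s \<in> {0..}" for x s
      using ft[of s x] that by (simp add: has_field_derivative_def)
    have "continuous_on (UNIV \<times> {0..}) (\<lambda>z. blinfun_mult_right (case z of (x, t) \<Rightarrow> ft x t))"
      by (rule bounded_linear.continuous_on[OF bounded_linear_blinfun_mult_right c])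
    then show "continuous (at (g t, t) within UNIV \<times> {0..}) (\<lambda>(x, t). blinfun_mult_right (ft x t))"
      unfolding continuous_on_eq_continuous_within case_prod_unfold using t by auto
  qed (use t in auto)
  \<comment> \<open>The composition rule asks for the derivative within the image of the inner map,
    here the graph of \<open>g\<close> over the half line.\<close>
  then have "((\<lambda>(x, t). f x t) has_derivative
      (\<lambda>(a, b). fx (g t) t * a + blinfun_mult_right (ft (g t) t) b))
      (at (g t, t) within (\<lambda>s. (g s, s)) ` {0..})"
    by (rule has_derivative_subset) auto
  moreover have "((\<lambda>s. (g s, s)) has_derivative (\<lambda>h. (g' * h, h))) (at t within {0..})"
    using g by (intro has_derivative_Pair has_derivative_ident) (simp add: has_field_derivative_def)
  note has_derivative_in_compose[OF this calculation]
  then have "((\<lambda>s. f (g s) s) has_derivative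
      (\<lambda>h. (fx (g t) t * g' + ft (g t) t) * h)) (at t within {0..})"
    by (simp add: distrib_right mult.assoc)
  then show ?thesis
    by (simp add: has_field_derivative_def)
qed

text \<open>For an antiderivative \<open>F\<close>, periodicity of \<open>f\<close> makes
  \<open>F (x + 1) - F x\<close> constant in \<open>x\<close>.\<close>

lemma has_integral_periodic_shift:
  fixes f :: "real \<Rightarrow> real"
  assumes c: "\<And>x. isCont f x" and per: "\<And>x. f (x + 1) = f x"
    and int: "(f has_integral I) {0..1}"
  shows "((\<lambda>s. f (x + s)) has_integral I) {0..1}"
proof -
  obtain F where dF: "\<And>x. (F has_real_derivative f x) (at x)"
    using antiderivative_ex c by blast
  have *: "((\<lambda>s. f (y + s)) has_integral F (y + 1) - F y) {0..1}" for y
  proof -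
    have "((\<lambda>s. f (y + s)) has_integral F (y + 1) - F (y + 0)) {0..1}"
    proof (rule fundamental_theorem_of_calculus)
      fix s
      have "((\<lambda>s. F (y + s)) has_real_derivative f (y + s)) (at s)"
        using dF[of "y + s"] DERIV_shift[of F "f (y + s)" s y] by (simp add: add.commute)
      then show "((\<lambda>s. F (y + s)) has_vector_derivative f (y + s)) (at s within {0..1})"
        by (simp add: has_real_derivative_iff_has_vector_derivative has_vector_derivative_at_within)
    qed simp
    then show ?thesis by simp
  qed
  have "\<forall>x. ((\<lambda>x. F (x + 1) - F x) has_real_derivative 0) (at x)"
    using dF DERIV_shift[of F] by (auto intro!: derivative_eq_intros simp: per)
  then have "F (x + 1) - F x = F (0 + 1) - F 0"
    by (rule DERIV_isconst_all)
  moreover have "F (0 + 1) - F 0 = I"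
    using has_integral_unique[OF *[of 0]] int by simp
  ultimately show ?thesis using *[of x] by simp
qed

section \<open>The mean velocity of an arbitrary orbit\<close>

text \<open>The functional \<open>N\<close> decreases at the exact rate \<open>V * q\<close> and
  stays within \<open>B + 1\<close> of \<open>x t - V * t\<close>. So
  \<open>x t - V * (1 - q) * t\<close> is bounded, and division by \<open>t\<close> gives the
  limit.\<close>

lemma orbit_mean_velocity:
  fixes \<sigma> V q :: real and \<psi> w U :: "real \<Rightarrow> real"
  assumes sig: "\<sigma> > 0" and smooth: "smooth_real \<psi>" and per: "\<And>x. \<psi> (x + 1) = \<psi> x"
    and Psi: "\<And>x t. \<Psi> x t = \<psi> (x - V * t)"
    and w1: "\<And>x. w (x + 1) = w x"
    and dw: "\<And>x. (w has_real_derivative ((deriv \<psi> x + V) * w x - V * q) / \<sigma>) (at x)"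
    and dU: "\<And>x. (U has_real_derivative w x) (at x)"
    and U1: "\<And>x. U (x + 1) = U x + 1" and UB: "\<And>x. \<bar>U x - x\<bar> \<le> B"
    and sol: "diffusion_solution \<sigma> \<Psi> \<rho>"
    and orbit: "particle_orbit (velocity \<sigma> \<Psi> \<rho>) x"
  shows "((\<lambda>t. x t / t) \<longlongrightarrow> V * (1 - q)) at_top"
proof -
  have "smooth_half_plane \<rho>"
    using sol by (simp add: diffusion_solution_def)
  then obtain D where D: "\<forall>x. \<forall>t\<ge>0. D 0 0 x t = \<rho> x t"
    and Dc: "\<forall>i j. continuous_on (UNIV \<times> {0..}) (\<lambda>(x, t). D i j x t)"
    and D': "\<forall>i j x. \<forall>t\<ge>0. ((\<lambda>y. D i j y t) has_real_derivative D (Suc i) j x t) (at x)"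
      "\<forall>i j x. \<forall>t\<ge>0. ((\<lambda>s. D i j x s) has_real_derivative D i (Suc j) x t) (at t within {0..})"
    unfolding smooth_half_plane_def by (elim exE conjE)
  have D0: "D 0 0 x t = \<rho> x t" if "t \<ge> 0" for x t
    using D that by simp
  have Dx: "((\<lambda>y. D i j y t) has_real_derivative D (Suc i) j x t) (at x)" if "t \<ge> 0" for i j x t
    using D'(1) that by simp
  have Dt: "((\<lambda>s. D i j x s) has_real_derivative D i (Suc j) x t) (at t within {0..})"
    if "t \<ge> 0" for i j x t
    using D'(2) that by simp
  have pos: "D 0 0 x t > 0" and rho1: "D 0 0 (x + 1) t = D 0 0 x t" 
    and mass: "((\<lambda>x. D 0 0 x t) has_integral 1) {0..1}" 
    if "t \<ge> 0" for x t
    using sol that by (simp_all add: diffusion_solution_def D0)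
  define P where "P n = (deriv ^^ n) \<psi>" for n
  have dP: "(P n has_real_derivative P (Suc n) y) (at y)" for n y
    unfolding P_def by (rule smooth_real_DERIV[OF smooth])
  have contP: "continuous_on S (\<lambda>z. P n (f z))"
    if "continuous_on S f" for n S and f :: "real \<times> real \<Rightarrow> real"
    by (rule continuous_on_compose2[OF _ that, of UNIV])
      (auto intro!: continuous_at_imp_continuous_on DERIV_isCont dP)
  have P1: "P (Suc 0) = deriv \<psi>" by (simp add: P_def)
  have dPsh: "((\<lambda>y. P n (y - c)) has_real_derivative P (Suc n) (y - c)) (at y)" for n c y
    using DERIV_shift[of "P n" "P (Suc n) (y - c)" y "-c"] dP by simp
  have dxPsi: "dx \<Psi> y t = P 1 (y - V * t)" for y t
    using dPsh[of 0 "V * t" y] by (simp add: dx_def Psi P_def DERIV_imp_deriv)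
  have dxrho: "dx \<rho> y t = D 1 0 y t" if "t \<ge> 0" for y t
    using Dx[of t 0 0 y] that by (simp add: dx_def D0 DERIV_imp_deriv)
  \<comment> \<open>\<open>j\<close> is minus the flux \<rho> v: the diffusion equation equates the
    time derivative of \<rho> with the space derivative of \<open>j\<close>.\<close>
  define j where "j y t = \<sigma> * D 1 0 y t + P 1 (y - V * t) * D 0 0 y t" for y t
  define j' where "j' y t = \<sigma> * D 2 0 y t + P 2 (y - V * t) * D 0 0 y t + P 1 (y - V * t) * D 1 0 y t"
    for y t
  have dj: "((\<lambda>y. j y t) has_real_derivative j' y t) (at y)" if "t \<ge> 0" for y t
    unfolding j_def j'_def using Dx[OF that, of 0 0] Dx[OF that, of 1 0] dPsh[of 1]
    by (auto intro!: derivative_eq_intros simp: numeral_2_eq_2)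
  have Dt0: "D 0 1 y t = j' y t" if t: "t \<ge> 0" for y t
  proof -
    have "(\<rho> y has_real_derivative
        dx (\<lambda>y s. \<sigma> * dx \<rho> y s + dx \<Psi> y s * \<rho> y s) y t) (at t within {0..})"
      using sol t by (simp add: diffusion_solution_def)
    also have "dx (\<lambda>y s. \<sigma> * dx \<rho> y s + dx \<Psi> y s * \<rho> y s) y t = j' y t"
      using dj[OF t, of y] t by (simp add: dx_def[of "\<lambda>y s. _ y s + _ y s"] j_def dxrho dxPsi D0 DERIV_imp_deriv)
    finally have "(\<rho> y has_real_derivative j' y t) (at t within {0..})" .
    moreover have "(\<rho> y has_real_derivative D 0 1 y t) (at t within {0..})"
      by (rule has_field_derivative_transform_within[where d = 1 and f = "D 0 0 y"])
        (use Dt[OF t, of 0 0 y] t D0 in auto)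
    \<comment> \<open>One-sided derivatives are unique also at \<open>t = 0\<close>, so the abstract
      time derivative \<open>D 0 1\<close> can be identified with the right-hand side of the
      equation.\<close>
    moreover have "at t within {0..} \<noteq> bot"
      using at_le[of "{t<..}" "{0..}" t] t trivial_limit_at_right_real[of t]
      by (metis bot_unique atLeast_iff greaterThan_iff less_imp_le order_trans subsetI)
    ultimately show ?thesis
      by (metis has_field_derivative_unique)
  qed
  define v where "v t = - j (x t) t / D 0 0 (x t) t" for t
  have dxt: "(x has_real_derivative v t) (at t within {0..})" if t: "t \<ge> 0" for t
  proof -
    have "velocity \<sigma> \<Psi> \<rho> (x t) t = v t"
      using pos[OF t, of "x t"] t
      by (simp add: velocity_def v_def j_def dxrho dxPsi D0[symmetric] field_simps)
    then show ?thesis using orbit t by (metis particle_orbit_def)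
  qed
  have Dcont: "continuous_on S (\<lambda>z. D i k (f z) (g z))"
    if "continuous_on S f" "continuous_on S g" "\<And>z. z \<in> S \<Longrightarrow> 0 \<le> g z"
    for i k S and f g :: "real \<times> real \<Rightarrow> real"
  proof -
    have "(\<lambda>z. (f z, g z)) ` S \<subseteq> UNIV \<times> {0..}" using that(3) by blast
    from continuous_on_compose2[OF Dc[rule_format, of i k] continuous_on_Pair[OF that(1,2)] this]
    show ?thesis by simp
  qed
  have xcont: "continuous_on {0..} x"
    using dxt DERIV_continuous continuous_on_eq_continuous_within by (metis atLeast_iff)
  have cont_w: "continuous_on S (\<lambda>z. w (f z))" and cont_U: "continuous_on S (\<lambda>z. U (f z))"
    if "continuous_on S f" for S and f :: "real \<times> real \<Rightarrow> real"
    by (rule continuous_on_compose2[OF _ that, of UNIV];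
        auto intro!: continuous_at_imp_continuous_on DERIV_isCont dw dU)+
  have fstx: "continuous_on ({0..} \<times> {0..1}) (\<lambda>z::real \<times> real. x (fst z))"
    by (rule continuous_on_compose2[OF xcont continuous_on_fst[OF continuous_on_id]]) auto
  have shift: "((\<lambda>s. F (c + s)) has_real_derivative F') (at s)"
    if "(F has_real_derivative F') (at (c + s))" for F F' c and s :: real
    using that DERIV_shift[of F F' s c] by (simp add: add.commute)
  \<comment> \<open>The variable \<open>s\<close> is the distance ahead of the particle, and
    \<open>\<xi>\<close> is the position in the moving frame. The period to be integrated over
    becomes the fixed interval from 0 to 1, so differentiation under the integral produces no
    boundary terms.\<close>
  define \<xi> where "\<xi> t s = x t - V * t + s" for t s
  define f where "f t s = U (\<xi> t s) * D 0 0 (x t + s) t" for t s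
  define fd where "fd t s = w (\<xi> t s) * (v t - V) * D 0 0 (x t + s) t
      + U (\<xi> t s) * (D 1 0 (x t + s) t * v t + D 0 1 (x t + s) t)" for t s
  define N where "N t = integral (cbox 0 1) (f t)" for t
  have df: "((\<lambda>t. f t s) has_real_derivative fd t s) (at t within {0..})" if t: "t \<ge> 0" for t s
  proof -
    have "((\<lambda>t. x t + s) has_real_derivative v t) (at t within {0..})"
      using dxt[OF t] by (auto intro!: derivative_eq_intros)
    from DERIV_comp_half_plane[where f = "D 0 0" and fx = "D 1 0" and ft = "D 0 1", OF _ _ _ this t]
    have "((\<lambda>t. D 0 0 (x t + s) t) has_real_derivative
        D 1 0 (x t + s) t * v t + D 0 1 (x t + s) t) (at t within {0..})"
      using Dx[of _ 0 0] Dt[of _ 0 0] Dc by simp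
    moreover have "((\<lambda>t. \<xi> t s) has_real_derivative v t - V) (at t within {0..})"
      unfolding \<xi>_def using dxt[OF t] by (auto intro!: derivative_eq_intros)
    then have "((\<lambda>t. U (\<xi> t s)) has_real_derivative w (\<xi> t s) * (v t - V)) (at t within {0..})"
      by (rule DERIV_chain2[OF dU])
    ultimately show ?thesis
      unfolding f_def fd_def by (auto intro!: derivative_eq_intros)
  qed
  have D00s: "((\<lambda>s. D 0 0 (x t + s) t) has_real_derivative D 1 0 (x t + s) t) (at s)"
    if "t \<ge> 0" for t s
    using shift[OF Dx[OF that, of 0 0]] by simp
  have mass': "((\<lambda>s. D 0 0 (x t + s) t) has_integral 1) {0..1}" if t: "t \<ge> 0" for t
    by (rule has_integral_periodic_shift[OF DERIV_isCont[OF Dx[OF t]] rho1[OF t] mass[OF t]])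
  have xi_s: "((\<lambda>s. F (\<xi> t s)) has_real_derivative F' (\<xi> t s)) (at s)"
    if "\<And>y. (F has_real_derivative F' y) (at y)" for F F' t s
    unfolding \<xi>_def by (rule shift[OF that])
  have f_int: "f t integrable_on {0..1}" if "t \<ge> 0" for t
  proof -
    have "continuous_on {0..1} (f t)"
      unfolding f_def using DERIV_isCont[OF D00s[OF that]] DERIV_isCont[OF xi_s[OF dU]]
      by (intro continuous_intros continuous_at_imp_continuous_on) auto
    then show ?thesis by (rule integrable_continuous_real)
  qed
  have v_cont: "continuous_on ({0..} \<times> {0..1}) (\<lambda>z::real \<times> real. v (fst z))"
  proof -
    have "D 0 0 (x (fst z)) (fst z) \<noteq> 0" if "z \<in> {0..} \<times> {0..1}" for z :: "real \<times> real"
      using pos[of "fst z" "x (fst z)"] that by auto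
    then show ?thesis
      unfolding v_def j_def by (intro continuous_intros Dcont fstx contP) auto
  qed
  have fd_cont: "continuous_on ({0..} \<times> cbox 0 1) (\<lambda>(t, s). fd t s)"
    unfolding case_prod_unfold fd_def \<xi>_def cbox_interval
    by (intro continuous_intros Dcont fstx v_cont cont_w cont_U) auto
  have dN: "(N has_real_derivative integral {0..1} (fd t)) (at t within {0..})" if t: "t \<ge> 0" for t
    unfolding N_def
    using leibniz_rule_field_derivative[of "{0..}" 0 1 f fd t] df f_int fd_cont t by simp
  have fd_int: "(fd t has_integral - V * q) {0..1}" if t: "t \<ge> 0" for t
  proof -
    \<comment> \<open>The adjoint equation for \<open>w\<close> makes the integrand a total derivative minus \<open>V q \<rho>\<close>.\<close>
    define A where "A s = v t * U (\<xi> t s) * D 0 0 (x t + s) t + U (\<xi> t s) * j (x t + s) t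
        - \<sigma> * w (\<xi> t s) * D 0 0 (x t + s) t" for s
    have dA: "(A has_real_derivative fd t s + V * q * D 0 0 (x t + s) t) (at s)" for s
    proof -
      have js: "j (x t + s) t = \<sigma> * D 1 0 (x t + s) t + deriv \<psi> (\<xi> t s) * D 0 0 (x t + s) t"
        by (simp add: j_def P1 \<xi>_def algebra_simps)
      show ?thesis
        unfolding A_def fd_def Dt0[OF t]
        by (rule xi_s[OF dw] xi_s[OF dU] D00s[OF t] shift[OF dj[OF t]] derivative_eq_intros refl)+
          (use sig in \<open>simp add: js, simp add: field_simps\<close>)
    qed
    have "((\<lambda>s. fd t s + V * q * D 0 0 (x t + s) t) has_integral A 1 - A 0) {0..1}"
      using dA by (intro fundamental_theorem_of_calculus)
        (auto simp: has_real_derivative_iff_has_vector_derivative[symmetric] has_field_derivative_at_within)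
    from has_integral_diff[OF this has_integral_mult_right[OF mass'[OF t], of "V * q"]]
    have "(fd t has_integral A 1 - A 0 - V * q) {0..1}" by simp
    \<comment> \<open>All factors of \<open>A\<close> are periodic except \<open>U\<close>, which
      gains 1. What remains is v \<rho> + j at the particle, and this vanishes because the particle
      moves with velocity -j/\<rho>. That is why the period starts at the particle.\<close>
    moreover have "A 1 - A 0 = 0"
    proof -
      have "D 1 0 (x t + 1) t = D 1 0 (x t) t"
        by (rule periodic_deriv[where f = "\<lambda>y. D 0 0 y t"]) (use Dx[OF t, of 0 0] rho1[OF t] in auto)
      moreover have "deriv \<psi> (x t - V * t + 1) = deriv \<psi> (x t - V * t)"
        by (rule periodic_deriv[where f = \<psi>]) (use dP[of 0] per in \<open>auto simp: P_def\<close>)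
      ultimately have "j (x t + 1) t = j (x t) t"
        using rho1[OF t, of "x t"] by (simp add: j_def P1 algebra_simps)
      moreover have "v t * D 0 0 (x t) t = - j (x t) t"
        using pos[OF t, of "x t"] by (simp add: v_def)
      moreover have "A 1 - A 0 = v t * D 0 0 (x t) t + j (x t) t"
        using rho1[OF t, of "x t"] calculation(1)
        by (simp add: A_def \<xi>_def U1 w1, simp add: algebra_simps)
      ultimately show ?thesis by simp
    qed
    ultimately show ?thesis by simp
  qed
  have "((\<lambda>t. N t + V * q * t) has_real_derivative 0) (at t within {0..})" if "t \<in> {0..}" for t
    using dN[of t] fd_int[of t] that
    by (auto intro!: derivative_eq_intros simp: integral_unique)
  then obtain c where c: "\<And>t. t \<ge> 0 \<Longrightarrow> N t + V * q * t = c"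
    using has_field_derivative_zero_constant[of "{0..}" "\<lambda>t. N t + V * q * t"] by auto
  \<comment> \<open>\<open>N\<close> averages \<open>U (\<xi> t s)\<close> against a density of mass
    one. \<open>U\<close> differs from the identity by at most \<open>B\<close>, and
    \<open>\<xi> t s\<close> from \<open>x t - V * t\<close> by at most 1.\<close>
  have Nx: "\<bar>N t - (x t - V * t)\<bar> \<le> B + 1" if t: "t \<ge> 0" for t
  proof -
    let ?z = "x t - V * t"
    have dev: "((\<lambda>s. f t s - ?z * D 0 0 (x t + s) t) has_integral N t - ?z * 1) {0..1}"
      unfolding N_def cbox_interval
      by (intro has_integral_diff has_integral_mult_right mass'[OF t] integrable_integral[OF f_int[OF t]])
    have dom: "((\<lambda>s. (B + 1) * D 0 0 (x t + s) t) has_integral (B + 1) * 1) {0..1}"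
      by (intro has_integral_mult_right mass'[OF t])
    have le: "norm (f t s - ?z * D 0 0 (x t + s) t) \<le> (B + 1) * D 0 0 (x t + s) t"
      if "s \<in> {0..1}" for s
    proof -
      have "f t s - ?z * D 0 0 (x t + s) t = (U (\<xi> t s) - ?z) * D 0 0 (x t + s) t"
        by (simp add: f_def algebra_simps)
      moreover have "\<bar>U (\<xi> t s) - ?z\<bar> \<le> B + 1"
        using UB[of "\<xi> t s"] that unfolding \<xi>_def atLeastAtMost_iff by linarith
      ultimately show ?thesis
        using pos[OF t, of "x t + s"] by (simp add: abs_mult mult_right_mono)
    qed
    have "norm (N t - ?z * 1) \<le> (B + 1) * 1"
      using integral_norm_bound_integral[OF has_integral_integrable[OF dev] has_integral_integrable[OF dom] le]
      unfolding integral_unique[OF dev] integral_unique[OF dom] .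
    then show ?thesis by simp
  qed
  have "\<forall>\<^sub>F t in at_top. norm (x t / t - V * (1 - q)) \<le> (\<bar>c\<bar> + B + 1) * (1 / t)"
    using eventually_gt_at_top[of 0]
  proof eventually_elim
    case (elim t)
    have "\<bar>x t - V * (1 - q) * t\<bar> \<le> \<bar>c\<bar> + B + 1"
      using Nx[of t] c[of t] elim by (simp add: algebra_simps)
    moreover have "x t / t - V * (1 - q) = (x t - V * (1 - q) * t) / t"
      using elim by (simp add: field_simps)
    ultimately show ?case using elim by (simp add: divide_right_mono)
  qed
  moreover have "((\<lambda>t. (\<bar>c\<bar> + B + 1) * (1 / t)) \<longlongrightarrow> 0) at_top"
    by (intro tendsto_mult_right_zero tendsto_divide_0[OF tendsto_const] filterlim_at_top_imp_at_infinity filterlim_ident)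
  ultimately have "((\<lambda>t. x t / t - V * (1 - q)) \<longlongrightarrow> 0) at_top"
    by (rule Lim_null_comparison)
  then show ?thesis by (simp add: LIM_zero_iff)
qed

section \<open>Existence of a solution and of one of its orbits\<close>

text \<open>The equation for \<open>p\<close> says that \<sigma> p' + (\<psi>' + V) p has the
  constant value \<open>k\<close>, so \<open>p\<close> translated with speed \<open>V\<close> solves
  the diffusion equation. In the moving frame the orbit equation is z' = -k / p(z), which is
  separable and is solved by inverting the antiderivative \<open>U\<close> of
  \<open>p\<close>.\<close>

lemma travelling_wave_solution:
  fixes \<sigma> V k :: real and \<psi> p U :: "real \<Rightarrow> real"
  assumes sig: "\<sigma> > 0" and smooth: "smooth_real \<psi>"
    and Psi: "\<And>x t. \<Psi> x t = \<psi> (x - V * t)"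
    and ppos: "\<And>x. p x > 0" and p1: "\<And>x. p (x + 1) = p x"
    and dp: "\<And>x. (p has_real_derivative (k - (deriv \<psi> x + V) * p x) / \<sigma>) (at x)"
    and dU: "\<And>x. (U has_real_derivative p x) (at x)"
    and U1: "\<And>x. U (x + 1) = U x + 1" and UB: "\<And>x. \<bar>U x - x\<bar> \<le> B"
  obtains \<rho> x where "diffusion_solution \<sigma> \<Psi> \<rho>" "particle_orbit (velocity \<sigma> \<Psi> \<rho>) x"
proof -
  define P where "P n = (deriv ^^ n) p" for n
  have "smooth_real p"
  proof (rule smooth_real_linear_ode)
    show "(p has_real_derivative k / \<sigma> + (- 1 / \<sigma>) * (deriv \<psi> x + V) * p x) (at x)" for x
      using dp[of x] by (simp add: diff_divide_distrib)
    show "smooth_real (\<lambda>x. (- 1 / \<sigma>) * (deriv \<psi> x + V))"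
      using smooth_real_deriv[OF smooth] unfolding smooth_real_iff_upto
      by (intro allI differentiable_upto_mult differentiable_upto_add differentiable_upto_const) blast
  qed
  then have dP: "(P n has_real_derivative P (Suc n) x) (at x)" for n x
    unfolding P_def by (rule smooth_real_DERIV)
  have P0: "P 0 = p" by (simp add: P_def)
  have P1: "P (Suc 0) x = (k - (deriv \<psi> x + V) * p x) / \<sigma>" for x
    using dP[of 0 x] dp[of x] by (simp add: P0 DERIV_unique)
  define \<rho> where "\<rho> x t = p (x - V * t)" for x t
  \<comment> \<open>Each time derivative of the wave is a space derivative multiplied by
    \<open>- V\<close>.\<close>
  define D where "D i j x t = (- V) ^ j * P (i + j) (x - V * t)" for i j :: nat and x t
  have Dx: "((\<lambda>y. D i j y t) has_real_derivative D (Suc i) j x t) (at x)" for i j x t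
    unfolding D_def by (auto intro!: derivative_eq_intros DERIV_chain2[OF dP])
  have Dt: "((\<lambda>s. D i j x s) has_real_derivative D i (Suc j) x t) (at t)" for i j x t
    unfolding D_def by (auto intro!: derivative_eq_intros DERIV_chain2[OF dP])
  have contP: "continuous_on S (\<lambda>z. P n (f z))"
    if "continuous_on S f" for n S and f :: "real \<times> real \<Rightarrow> real"
    by (rule continuous_on_compose2[OF _ that, of UNIV])
      (auto intro!: continuous_at_imp_continuous_on DERIV_isCont dP)
  have smooth_rho: "smooth_half_plane \<rho>"
    unfolding smooth_half_plane_def
  proof (intro exI[of _ D] conjI allI impI)
    show "continuous_on (UNIV \<times> {0..}) (\<lambda>(x, t). D i j x t)" for i j
      unfolding D_def case_prod_unfold by (intro continuous_intros contP)
    show "((\<lambda>s. D i j x s) has_real_derivative D i (Suc j) x t) (at t within {0..})" for i j x t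
      using Dt by (rule has_field_derivative_at_within)
  qed (simp_all add: D_def[of 0 0] \<rho>_def P0 Dx)
  have dxrho: "dx \<rho> y t = P (Suc 0) (y - V * t)" for y t
    using Dx[of 0 0 t y] by (simp add: dx_def D_def \<rho>_def P0 DERIV_imp_deriv)
  have dpsi: "(\<psi> has_real_derivative deriv \<psi> y) (at y)" for y
    using smooth_real_DERIV[OF smooth, of 0] by simp
  have "((\<lambda>y. \<psi> (y - V * t)) has_real_derivative deriv \<psi> (y - V * t)) (at y)" for y t
    using DERIV_shift[of \<psi> "deriv \<psi> (y - V * t)" y "- (V * t)"] dpsi by simp
  then have dxPsi: "dx \<Psi> y t = deriv \<psi> (y - V * t)" for y t
    by (simp add: dx_def Psi DERIV_imp_deriv)
  \<comment> \<open>The constant \<open>k\<close> drops out on differentiation, which leaves the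
    transport equation with speed \<open>V\<close>.\<close>
  have flux: "(\<lambda>y s. \<sigma> * dx \<rho> y s + dx \<Psi> y s * \<rho> y s) = (\<lambda>y s. k - V * \<rho> y s)"
    using sig by (intro ext) (simp add: dxrho dxPsi P1 \<rho>_def field_simps)
  have dflux: "dx (\<lambda>y s. k - V * \<rho> y s) y t = - V * P (Suc 0) (y - V * t)" for y t
  proof -
    have "((\<lambda>y. \<rho> y t) has_real_derivative P (Suc 0) (y - V * t)) (at y)"
      using Dx[of 0 0 t y] by (simp add: D_def \<rho>_def P0)
    then have "((\<lambda>y. k - V * \<rho> y t) has_real_derivative - V * P (Suc 0) (y - V * t)) (at y)"
      by (auto intro!: derivative_eq_intros)
    then show ?thesis by (simp add: dx_def DERIV_imp_deriv)
  qed
  have sol: "diffusion_solution \<sigma> \<Psi> \<rho>"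
    unfolding diffusion_solution_def
  proof (intro conjI allI impI smooth_rho)
    fix x t :: real
    show "0 < \<rho> x t" by (simp add: \<rho>_def ppos)
    show "\<rho> (x + 1) t = \<rho> x t"
      using p1[of "x - V * t"] by (simp add: \<rho>_def algebra_simps)
    show "((\<lambda>s. \<rho> x s) has_real_derivative
        dx (\<lambda>y s. \<sigma> * dx \<rho> y s + dx \<Psi> y s * \<rho> y s) x t) (at t within {0..})"
      using Dt[of 0 0 x t] unfolding flux dflux
      by (simp add: D_def P0 \<rho>_def has_field_derivative_at_within)
    have "((\<lambda>x. \<rho> x t) has_integral U (1 - V * t) - U (0 - V * t)) {0..1}"
    proof (rule fundamental_theorem_of_calculus)
      fix y
      have "((\<lambda>y. U (y - V * t)) has_real_derivative \<rho> y t) (at y)"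
        unfolding \<rho>_def
        using DERIV_shift[of U "p (y - V * t)" y "- (V * t)"] dU by simp
      then show "((\<lambda>y. U (y - V * t)) has_vector_derivative \<rho> y t) (at y within {0..1})"
        by (simp add: has_real_derivative_iff_has_vector_derivative has_vector_derivative_at_within)
    qed simp
    then show "((\<lambda>x. \<rho> x t) has_integral 1) {0..1}"
      using U1[of "- V * t"] by (simp add: add.commute)
  qed
  have Ucont: "isCont U y" for y
    using dU by (rule DERIV_isCont)
  have "strict_mono U"
    using DERIV_pos_imp_increasing[of _ _ U] dU ppos by (intro strict_monoI) blast
  then have "inj U" by (rule strict_mono_imp_inj_on)
  have surj: "\<exists>z. U z = y" for y
  proof -
    have "B \<ge> 0" using UB[of 0] by linarith
    then have "\<exists>z. y - B \<le> z \<and> z \<le> y + B \<and> U z = y"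
      using UB[of "y - B"] UB[of "y + B"] Ucont by (intro IVT) auto
    then show ?thesis by blast
  qed
  define R where "R = inv U"
  have UR: "U (R y) = y" for y
    using surj by (metis R_def f_inv_into_f rangeI)
  have RU: "R (U y) = y" for y
    using \<open>inj U\<close> by (simp add: R_def)
  have Rcont: "isCont R y" for y
    using isCont_inverse_function[where d = 1 and f = U and g = R and x = "R y"] RU Ucont UR by simp
  have dR: "(R has_real_derivative inverse (p (R y))) (at y)" for y
    using DERIV_inverse_function[where f = U and g = R and x = y and D = "p (R y)" and a = "y - 1" and b = "y + 1"] dU ppos[of "R y"] UR Rcont by simp
  \<comment> \<open>Separation of variables: \<open>U\<close> of the moving-frame position decreases
    at the constant rate \<open>k\<close>, starting from 0.\<close>
  define x where "x t = R (- k * t) + V * t" for t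
  have "(x has_real_derivative velocity \<sigma> \<Psi> \<rho> (x t) t) (at t)" for t
  proof -
    have "velocity \<sigma> \<Psi> \<rho> (x t) t = V - k / p (R (- k * t))"
      using sig ppos[of "R (- k * t)"]
      by (simp add: velocity_def dxPsi dxrho P1 \<rho>_def x_def field_simps)
    then show ?thesis
      unfolding x_def
      by (auto intro!: derivative_eq_intros DERIV_chain2[OF dR] simp: field_simps)
  qed
  then have "particle_orbit (velocity \<sigma> \<Psi> \<rho>) x"
    unfolding particle_orbit_def by (blast intro: has_field_derivative_at_within)
  with sol show thesis by (rule that)
qed

section \<open>Identification of the mean velocity, its sign and its size\<close>

theorem proposition1p1:
  fixes \<sigma> V :: real and \<psi> :: "real \<Rightarrow> real" and \<Psi> :: "real \<Rightarrow> real \<Rightarrow> real"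
  assumes "\<sigma> > 0"
    and "smooth_real \<psi>"
    and "\<forall>x. \<psi> (x + 1) = \<psi> x"
    and "\<forall>x t. \<Psi> x t = \<psi> (x - V * t)"
  shows "(transport_process \<sigma> \<Psi> \<longleftrightarrow> V \<noteq> 0 \<and> \<not> \<psi> constant_on UNIV) \<and>
    mean_velocity \<sigma> \<Psi> * V \<ge> 0 \<and>
    (mean_velocity \<sigma> \<Psi> \<noteq> 0 \<longrightarrow> sgn (mean_velocity \<sigma> \<Psi>) = sgn V) \<and>
    \<bar>mean_velocity \<sigma> \<Psi>\<bar> \<le> \<bar>V\<bar>"
proof -
  have sig: "\<sigma> > 0" and smooth: "smooth_real \<psi>" and per: "\<And>x. \<psi> (x + 1) = \<psi> x"
    and Psi: "\<And>x t. \<Psi> x t = \<psi> (x - V * t)"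
    using assms by auto
  have dpsi: "(\<psi> has_real_derivative deriv \<psi> x) (at x)" for x
    using smooth_real_DERIV[OF smooth, of 0] by simp
  have scaled: "((\<lambda>y. c * \<psi> y) has_real_derivative c * deriv \<psi> x) (at x)" for c x
    by (rule DERIV_cmult[OF dpsi])
  have scaled_per: "c * \<psi> (x + 1) = c * \<psi> x" for c x
    by (simp add: per)
  \<comment> \<open>The adjoint equation \<sigma> w' = (\<psi>' + V) w - V q is the profile equation
    with \<phi> = -\<psi>/\<sigma> and a = -V/\<sigma>.\<close>
  obtain w U q B where
    "\<And>x. w x > 0" and w1: "\<And>x. w (x + 1) = w x"
    and dw: "\<And>x. (w has_real_derivative - (V / \<sigma>) * q - (- (1 / \<sigma>) * deriv \<psi> x + - (V / \<sigma>)) * w x) (at x)"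
    and U: "\<And>x. (U has_real_derivative w x) (at x)" "\<And>x. U (x + 1) = U x + 1" "\<And>x. \<bar>U x - x\<bar> \<le> B"
    and q: "0 < q" "q \<le> 1" "- (V / \<sigma>) \<noteq> 0 \<longrightarrow> (q = 1 \<longleftrightarrow> (\<forall>x. - (1 / \<sigma>) * deriv \<psi> x = 0))"
  proof (rule periodic_profile[OF scaled scaled_per, of "- (V / \<sigma>)" "- (1 / \<sigma>)"], goal_cases)
    case (1 h U q B)
    from 1(2-) show ?case by (rule 1(1))
  qed
  have dw': "(w has_real_derivative ((deriv \<psi> x + V) * w x - V * q) / \<sigma>) (at x)" for x
    by (rule DERIV_cong[OF dw]) (use sig in \<open>simp add: field_simps\<close>)
  note limit = orbit_mean_velocity[where \<psi> = \<psi> and \<Psi> = \<Psi>, OF sig smooth per Psi w1 dw' U]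
  \<comment> \<open>With the signs of \<psi> and V kept, the same profile equation gives the
    stationary density in the moving frame, with k = V q'.\<close>
  obtain p U' q' B' where p: "\<And>x. p x > 0" "\<And>x. p (x + 1) = p x"
    and dp: "\<And>x. (p has_real_derivative V / \<sigma> * q' - (1 / \<sigma> * deriv \<psi> x + V / \<sigma>) * p x) (at x)"
    and U': "\<And>x. (U' has_real_derivative p x) (at x)" "\<And>x. U' (x + 1) = U' x + 1" "\<And>x. \<bar>U' x - x\<bar> \<le> B'"
    and "0 < q'" "q' \<le> 1" "V / \<sigma> \<noteq> 0 \<longrightarrow> (q' = 1 \<longleftrightarrow> (\<forall>x. 1 / \<sigma> * deriv \<psi> x = 0))"
  proof (rule periodic_profile[OF scaled scaled_per, of "V / \<sigma>" "1 / \<sigma>"], goal_cases)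
    case (1 h U q B)
    from 1(2-) show ?case by (rule 1(1))
  qed
  have dp': "(p has_real_derivative (V * q' - (deriv \<psi> x + V) * p x) / \<sigma>) (at x)" for x
    by (rule DERIV_cong[OF dp]) (use sig in \<open>simp add: field_simps\<close>)
  obtain \<rho> x where wave: "diffusion_solution \<sigma> \<Psi> \<rho>" "particle_orbit (velocity \<sigma> \<Psi> \<rho>) x"
    using travelling_wave_solution[where \<psi> = \<psi> and \<Psi> = \<Psi>, OF sig smooth Psi p dp' U'] by blast
  have kappa: "mean_velocity \<sigma> \<Psi> = V * (1 - q)"
    unfolding mean_velocity_def
  proof (rule the_equality)
    show "\<forall>\<rho> x. diffusion_solution \<sigma> \<Psi> \<rho> \<longrightarrow> particle_orbit (velocity \<sigma> \<Psi> \<rho>) x \<longrightarrow>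
        ((\<lambda>t. x t / t) \<longlongrightarrow> V * (1 - q)) at_top"
      using limit by blast
  next
    fix \<kappa>
    assume "\<forall>\<rho> x. diffusion_solution \<sigma> \<Psi> \<rho> \<longrightarrow> particle_orbit (velocity \<sigma> \<Psi> \<rho>) x \<longrightarrow>
        ((\<lambda>t. x t / t) \<longlongrightarrow> \<kappa>) at_top"
    with wave have "((\<lambda>t. x t / t) \<longlongrightarrow> \<kappa>) at_top" by blast
    with limit[OF wave] show "\<kappa> = V * (1 - q)"
      using tendsto_unique[OF trivial_limit_at_top_linorder] by blast
  qed
  have const: "\<psi> constant_on UNIV \<longleftrightarrow> (\<forall>x. deriv \<psi> x = 0)"
  proof
    assume "\<psi> constant_on UNIV"
    then obtain c where "\<psi> = (\<lambda>_. c)" by (auto simp: constant_on_def)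
    then show "\<forall>x. deriv \<psi> x = 0" by simp
  next
    assume "\<forall>x. deriv \<psi> x = 0"
    then have "\<forall>x. (\<psi> has_real_derivative 0) (at x)" using dpsi by metis
    then have "\<psi> x = \<psi> 0" for x using DERIV_isconst_all by blast
    then show "\<psi> constant_on UNIV" by (auto simp: constant_on_def)
  qed
  \<comment> \<open>For V = 0 the value \<open>V * (1 - q)\<close> is zero whatever \<open>q\<close>
    is, so the equality case is required only for V nonzero.\<close>
  have "V \<noteq> 0 \<Longrightarrow> q = 1 \<longleftrightarrow> \<psi> constant_on UNIV"
    using q(3) sig by (simp add: const)
  then have "transport_process \<sigma> \<Psi> \<longleftrightarrow> V \<noteq> 0 \<and> \<not> \<psi> constant_on UNIV"
    unfolding transport_process_def kappa by auto
  moreover have "V\<^sup>2 * (1 - q) \<ge> 0"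
    using q(2) by simp
  then have "V * (1 - q) * V \<ge> 0"
    by (simp add: power2_eq_square mult_ac)
  moreover have "V * (1 - q) \<noteq> 0 \<longrightarrow> sgn (V * (1 - q)) = sgn V"
    using q(2) by (simp add: sgn_mult)
  moreover have "\<bar>V * (1 - q)\<bar> \<le> \<bar>V\<bar>"
    using q(1,2) by (simp add: abs_mult mult_left_le)
  ultimately show ?thesis
    unfolding kappa by blast
qed

end
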